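(* If $(X,T)$ is an almost $\mathcal{F}$-diam-mean equicontinuous dynamical system, then also $(\mathcal{H}(X),T)$ is almost $\mathcal{F}$-diam-mean equicontinuous.
   Context: A dynamical system $(X,T)$ is a compact metric space $(X,d)$ with a continuous surjection $T\colon X\to X$. $\mathcal{H}(X)$ is the set of closed non-empty subsets of $X$ with the Hausdorff metric, a compact metric space; $TA:=T(A)$ for $A\in\mathcal{H}(X)$, and $(\mathcal{H}(X),T)$ is a dynamical system. For any dynamical system $(X,T)$: $B_\delta(x)=\{x'\in X:d(x,x')\le\delta\}$; for non-empty closed $A\subseteq X$ the $\mathcal{F}$-mean diameter is $\operatorname{Diam}_{\mathcal{F}}(A)=\limsup_{n\to\infty}\frac1n\sum_{k=0}^{n-1}\operatorname{diam}(T^kA)$ (the letter $\mathcal{F}$ only indicates averaging over $\{0,\dots,n-1\}$). A point $x\in X$ is an $\mathcal{F}$-diam-mean equicontinuity point if for all $\epsilon>0$ there is $\delta>0$ with $\operatorname{Diam}_{\mathcal{F}}(B_\delta(x))<\epsilon$. $(X,T)$ is almost $\mathcal{F}$-diam-mean equicontinuous if the set of its $\mathcal{F}$-diam-mean equicontinuity points is dense in $X$. *)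

theory Defs
  imports "HOL-Analysis.Analysis"
begin

context Metric_space
begin

definition mdiameter :: "'a set \<Rightarrow> real" where
  "mdiameter A = (if A = {} then 0 else SUP (x, y) \<in> A \<times> A. d x y)"

definition hyperspace :: "'a set set" where
  "hyperspace = {A. closedin mtopology A \<and> A \<noteq> {}}"

text \<open>The locale \<^locale>\<open>Metric_space\<close> demands a distance that is nonnegative on the whole type,
  hence the value 0 outside of the hyperspace. On compact spaces the suprema and infima below
  are taken over bounded non-empty sets.\<close>

definition hausdorff_dist :: "'a set \<Rightarrow> 'a set \<Rightarrow> real" where
  "hausdorff_dist A B =
    (if A \<in> hyperspace \<and> B \<in> hyperspace
     then max (SUP a\<in>A. INF b\<in>B. d a b) (SUP b\<in>B. INF a\<in>A. d a b)
     else 0)"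

end

locale dynamical_system = Metric_space X d
  for X :: "'a set" and d :: "'a \<Rightarrow> 'a \<Rightarrow> real" +
  fixes T :: "'a \<Rightarrow> 'a"
  assumes compact: "compact_space mtopology"
    and continuous: "continuous_map mtopology mtopology T"
    and surjective: "T ` X = X"
begin

definition mean_diameter :: "'a set \<Rightarrow> ereal" where
  "mean_diameter A =
    limsup (\<lambda>n. ereal ((1 / real n) * (\<Sum>k<n. mdiameter ((T ^^ k) ` A))))"

definition diam_mean_equicontinuity_point :: "'a \<Rightarrow> bool" where
  "diam_mean_equicontinuity_point x \<longleftrightarrow>
    x \<in> X \<and> (\<forall>\<epsilon>::real>0. \<exists>\<delta>>0. mean_diameter (mcball x \<delta>) < ereal \<epsilon>)"

definition almost_diam_mean_equicontinuous :: bool where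
  "almost_diam_mean_equicontinuous \<longleftrightarrow>
    mtopology closure_of {x. diam_mean_equicontinuity_point x} = X"

end

text \<open>The hyperspace of a dynamical system is a dynamical system, so the notions above apply to it.\<close>

context Metric_space
begin

lemma hyperspace_subset: "A \<in> hyperspace \<Longrightarrow> A \<subseteq> M"
  using closedin_subset[of mtopology A] by (simp add: hyperspace_def)

lemma hyperspace_nonempty: "A \<in> hyperspace \<Longrightarrow> A \<noteq> {}"
  by (auto simp: hyperspace_def)

lemma hausdorff_dist_le:
  assumes "A \<in> hyperspace" "B \<in> hyperspace"
    and 1: "\<And>a. a \<in> A \<Longrightarrow> \<exists>b\<in>B. d a b \<le> r"
    and 2: "\<And>b. b \<in> B \<Longrightarrow> \<exists>a\<in>A. d a b \<le> r"
  shows "hausdorff_dist A B \<le> r"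
proof -
  have bdd1: "bdd_below (d a ` S)" for a S by (rule bdd_belowI[of _ 0]) auto
  have bdd2: "bdd_below ((\<lambda>a. d a b) ` S)" for b S by (rule bdd_belowI[of _ 0]) auto
  have "(SUP a\<in>A. INF b\<in>B. d a b) \<le> r"
    using assms(1) by (intro cSUP_least) (auto simp: hyperspace_nonempty dest!: 1 intro: cINF_lower2 bdd1)
  moreover have "(SUP b\<in>B. INF a\<in>A. d a b) \<le> r"
    using assms(2) by (intro cSUP_least) (auto simp: hyperspace_nonempty dest!: 2 intro: cINF_lower2 bdd2)
  ultimately show ?thesis using assms by (simp add: hausdorff_dist_def)
qed

lemma hausdorff_dist_commute: "hausdorff_dist A B = hausdorff_dist B A"
  by (simp add: hausdorff_dist_def commute max.commute)

lemma hausdorff_dist_bound_exists: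
  assumes comp: "compact_space mtopology" and A: "A \<in> hyperspace" and B: "B \<in> hyperspace"
    and r: "hausdorff_dist A B < r" and a: "a \<in> A"
  shows "\<exists>b\<in>B. d a b < r"
proof -
  have "mbounded M"
    using comp compactin_imp_mbounded by (simp add: compact_space_def)
  then obtain K where K: "\<And>x y. x \<in> M \<Longrightarrow> y \<in> M \<Longrightarrow> d x y \<le> K"
    unfolding mbounded_alt by blast
  obtain b0 where b0: "b0 \<in> B" using B hyperspace_nonempty by blast
  have bdd: "bdd_below (d a ` S)" for a S by (rule bdd_belowI[of _ 0]) auto
  have "(INF b\<in>B. d a b) \<le> K" if "a \<in> A" for a
    using that A B b0 K hyperspace_subset by (intro cINF_lower2[OF bdd b0]) blast
  then have "bdd_above ((\<lambda>a. INF b\<in>B. d a b) ` A)"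
    by (intro bdd_aboveI[of _ K]) auto
  then have "(INF b\<in>B. d a b) \<le> (SUP a\<in>A. INF b\<in>B. d a b)"
    using a by (rule cSUP_upper2) auto
  also have "\<dots> < r" using r A B by (simp add: hausdorff_dist_def)
  finally show ?thesis using b0 by (subst (asm) cINF_less_iff) (auto simp: bdd)
qed

lemma hausdorff_dist_nonneg:
  assumes comp: "compact_space mtopology"
  shows "0 \<le> hausdorff_dist A B"
proof (cases "A \<in> hyperspace \<and> B \<in> hyperspace")
  case True
  then obtain a where "a \<in> A" using hyperspace_nonempty by blast
  then have "\<not> hausdorff_dist A B < 0"
    using hausdorff_dist_bound_exists[OF comp, of A B 0 a] True by (meson nonneg not_le)
  then show ?thesis by simp
qed (auto simp: hausdorff_dist_def)

lemma Metric_space_hyperspace: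
  assumes comp: "compact_space mtopology"
  shows "Metric_space hyperspace hausdorff_dist"
proof
  fix A B C
  show "0 \<le> hausdorff_dist A B" by (rule hausdorff_dist_nonneg[OF comp])
  show "hausdorff_dist A B = hausdorff_dist B A" by (rule hausdorff_dist_commute)
  assume A: "A \<in> hyperspace" and B: "B \<in> hyperspace"
  have sub: "A \<subseteq> B" if "hausdorff_dist A B = 0" "A \<in> hyperspace" "B \<in> hyperspace" for A B
  proof
    fix a assume "a \<in> A"
    have "\<exists>b\<in>B. b \<in> mball a r" if "r > 0" for r
      using hausdorff_dist_bound_exists[OF comp, of A B r a] \<open>a \<in> A\<close> that
        \<open>hausdorff_dist A B = 0\<close> \<open>A \<in> hyperspace\<close> \<open>B \<in> hyperspace\<close> hyperspace_subset
      by fastforce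
    then have "a \<in> mtopology closure_of B"
      using \<open>a \<in> A\<close> \<open>A \<in> hyperspace\<close> hyperspace_subset by (auto simp: metric_closure_of)
    then show "a \<in> B"
      using \<open>B \<in> hyperspace\<close> by (simp add: hyperspace_def closure_of_closedin)
  qed
  show "hausdorff_dist A B = 0 \<longleftrightarrow> A = B"
  proof
    assume "hausdorff_dist A B = 0"
    then show "A = B" using sub A B hausdorff_dist_commute by (metis subset_antisym)
  next
    assume "A = B"
    then have "hausdorff_dist A B \<le> 0"
      using A hyperspace_subset by (intro hausdorff_dist_le) force+
    then show "hausdorff_dist A B = 0" using hausdorff_dist_nonneg[OF comp, of A B] by simp
  qed
  assume C: "C \<in> hyperspace"
  have half: "\<exists>c\<in>C. d a c \<le> hausdorff_dist A B + hausdorff_dist B C + e"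
    if h: "e > 0" "a \<in> A" "A \<in> hyperspace" "B \<in> hyperspace" "C \<in> hyperspace" for a e A B C
  proof -
    obtain b where b: "b \<in> B" "d a b < hausdorff_dist A B + e/2"
      using hausdorff_dist_bound_exists[OF comp, of A B "hausdorff_dist A B + e/2" a] h by auto
    obtain c where c: "c \<in> C" "d b c < hausdorff_dist B C + e/2"
      using hausdorff_dist_bound_exists[OF comp, of B C "hausdorff_dist B C + e/2" b] h b by auto
    have "d a c \<le> d a b + d b c" using h b c hyperspace_subset by (intro triangle) auto
    then show ?thesis using b c by (intro bexI[of _ c]) auto
  qed
  show "hausdorff_dist A C \<le> hausdorff_dist A B + hausdorff_dist B C"
  proof (rule field_le_epsilon)
    fix e :: real assume e: "e > 0"
    show "hausdorff_dist A C \<le> hausdorff_dist A B + hausdorff_dist B C + e"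
    proof (rule hausdorff_dist_le[OF A C])
      show "\<exists>c\<in>C. d a c \<le> hausdorff_dist A B + hausdorff_dist B C + e" if "a \<in> A" for a
        using half[OF e that A B C] .
      show "\<exists>a\<in>A. d a c \<le> hausdorff_dist A B + hausdorff_dist B C + e" if "c \<in> C" for c
        using half[OF e that C B A]
        by (simp add: commute[of c] hausdorff_dist_commute[of C] hausdorff_dist_commute[of B A] add.commute)
    qed
  qed
qed

lemma compact_space_hyperspace:
  assumes comp: "compact_space mtopology"
  shows "compact_space (Metric_space.mtopology hyperspace hausdorff_dist)"
proof -
  interpret H: Metric_space hyperspace hausdorff_dist by (rule Metric_space_hyperspace[OF comp])
  note ex = hausdorff_dist_bound_exists[OF comp]
  have "H.mtotally_bounded hyperspace"
    unfolding H.mtotally_bounded_def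
  proof (intro allI impI)
    fix e :: real assume e: "e > 0"
    have "mtotally_bounded M" using comp compact_space_eq_mcomplete_mtotally_bounded by blast
    then obtain K where K: "finite K" "K \<subseteq> M" "M \<subseteq> (\<Union>x\<in>K. mball x (e/2))"
      using e unfolding mtotally_bounded_def by (meson half_gt_zero)
    let ?F = "{S. S \<subseteq> K \<and> S \<noteq> {}}"
    have F: "?F \<subseteq> hyperspace"
    proof
      fix S assume "S \<in> ?F"
      then have "compactin mtopology S"
        using K by (intro finite_imp_compactin) (auto intro: finite_subset)
      then show "S \<in> hyperspace"
        using \<open>S \<in> ?F\<close> by (simp add: hyperspace_def compactin_imp_closedin Hausdorff_space_mtopology)
    qed
    have "\<exists>S\<in>?F. A \<in> H.mball S e" if A: "A \<in> hyperspace" for A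
    proof -
      define S where "S = {x\<in>K. \<exists>a\<in>A. d x a < e/2}"
      have cover: "\<exists>x\<in>S. d x a < e/2" if "a \<in> A" for a
      proof -
        have "a \<in> M" using A that hyperspace_subset by blast
        then obtain x where "x \<in> K" "d x a < e/2" using K(3) by auto
        then show ?thesis using that by (auto simp: S_def)
      qed
      have S: "S \<in> ?F" using cover A hyperspace_nonempty[OF A] by (auto simp: S_def)
      have "hausdorff_dist S A \<le> e/2"
      proof (rule hausdorff_dist_le)
        show "S \<in> hyperspace" using S F by blast
        show "\<exists>a\<in>A. d x a \<le> e/2" if "x \<in> S" for x using that by (force simp: S_def)
        show "\<exists>x\<in>S. d x a \<le> e/2" if "a \<in> A" for a using cover[OF that] less_imp_le by blast
      qed (rule A)
      then show ?thesis using S F A e by (intro bexI[of _ S]) auto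
    qed
    then show "\<exists>K. finite K \<and> K \<subseteq> hyperspace \<and> hyperspace \<subseteq> (\<Union>x\<in>K. H.mball x e)"
      using F K(1) by (intro exI[of _ ?F]) auto
  qed
  moreover have "H.mcomplete"
    unfolding H.mcomplete_def
  proof (intro allI impI)
    fix \<sigma> assume "H.MCauchy \<sigma>"
    then have \<sigma>: "\<And>n. \<sigma> n \<in> hyperspace"
      and cau: "\<And>e. e > 0 \<Longrightarrow> \<exists>N. \<forall>n n'. N \<le> n \<longrightarrow> N \<le> n' \<longrightarrow> hausdorff_dist (\<sigma> n) (\<sigma> n') < e"
      unfolding H.MCauchy_def by blast+
    note \<sigma>M = hyperspace_subset[OF \<sigma>]
    define L where "L = {x\<in>M. \<forall>e>0. \<exists>N. \<forall>n\<ge>N. \<exists>a\<in>\<sigma> n. d x a < e}"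
    have L_clo: "closedin mtopology L"
    proof -
      have "x \<in> L" if x: "x \<in> mtopology closure_of L" for x
      proof -
        have xM: "x \<in> M" using x by (simp add: metric_closure_of)
        have "\<exists>N. \<forall>n\<ge>N. \<exists>a\<in>\<sigma> n. d x a < e" if e: "e > 0" for e
        proof -
          obtain y where y: "y \<in> L" "d x y < e/2"
            using x e unfolding metric_closure_of by (auto dest!: spec[of _ "e/2"])
          obtain N where N: "\<forall>n\<ge>N. \<exists>a\<in>\<sigma> n. d y a < e/2"
            using y(1) e unfolding L_def by (auto dest!: spec[of _ "e/2"])
          have "\<exists>a\<in>\<sigma> n. d x a < e" if "n \<ge> N" for n
          proof -
            obtain a where a: "a \<in> \<sigma> n" "d y a < e/2" using N \<open>n \<ge> N\<close> by blast
            have "d x a \<le> d x y + d y a"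
              using a xM \<sigma>M[of n] y(1) by (intro triangle) (auto simp: L_def)
            then show ?thesis using a y(2) by (intro bexI[of _ a]) auto
          qed
          then show ?thesis by blast
        qed
        then show ?thesis using xM by (simp add: L_def)
      qed
      then have "mtopology closure_of L \<subseteq> L" by blast
      moreover have "L \<subseteq> M" by (auto simp: L_def)
      ultimately show ?thesis by (simp add: closure_of_subset_eq[symmetric])
    qed
    have key: "\<exists>N. \<forall>n\<ge>N. (\<forall>a\<in>\<sigma> n. \<exists>x\<in>L. d x a \<le> e) \<and> (\<forall>x\<in>L. \<exists>a\<in>\<sigma> n. d x a \<le> e)"
      if e: "e > 0" for e
    proof -
      obtain N where N: "\<And>n n'. N \<le> n \<Longrightarrow> N \<le> n' \<Longrightarrow> hausdorff_dist (\<sigma> n) (\<sigma> n') < e/2"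
        using cau[of "e/2"] e by auto
      have 1: "\<exists>x\<in>L. d x a \<le> e" if n: "n \<ge> N" and a: "a \<in> \<sigma> n" for n a
      proof -
        have "\<exists>b. b \<in> \<sigma> (n + m) \<and> d a b < e/2" for m
          using ex[OF \<sigma> \<sigma> N[of n "n+m"] a] n by auto
        then obtain b where b: "\<And>m. b m \<in> \<sigma> (n + m)" "\<And>m. d a (b m) < e/2" by metis
        have bM: "\<And>m. b m \<in> M" using b(1) \<sigma>M by blast
        then obtain x r where x: "x \<in> M" and r: "strict_mono (r::nat\<Rightarrow>nat)"
          and lim: "limitin mtopology (b \<circ> r) x sequentially"
          using comp unfolding compact_space_sequentially by (metis image_subsetI)
        have near: "\<exists>m\<ge>k. d (b m) x < e'" if "e' > 0" for e' k
        proof -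
          have "\<forall>\<^sub>F i in sequentially. d (b (r i)) x < e'"
            using lim that by (auto simp: limitin_metric elim: eventually_mono)
          then obtain i0 where "\<forall>i\<ge>i0. d (b (r i)) x < e'" by (auto simp: eventually_sequentially)
          then show ?thesis
            using seq_suble[OF r, of "max i0 k"] by (intro exI[of _ "r (max i0 k)"]) auto
        qed
        have "x \<in> L"
        proof -
          have "\<exists>N'. \<forall>n'\<ge>N'. \<exists>c\<in>\<sigma> n'. d x c < e'" if e': "e' > 0" for e'
          proof -
            obtain N' where N': "\<And>n n'. N' \<le> n \<Longrightarrow> N' \<le> n' \<Longrightarrow> hausdorff_dist (\<sigma> n) (\<sigma> n') < e'/2"
              using cau[of "e'/2"] e' by auto
            obtain m where m: "m \<ge> N'" "d (b m) x < e'/2" using near[of "e'/2" N'] e' by auto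
            have "\<exists>c\<in>\<sigma> n'. d x c < e'" if n': "n' \<ge> N'" for n'
            proof -
              obtain c where c: "c \<in> \<sigma> n'" "d (b m) c < e'/2"
                using ex[OF \<sigma> \<sigma> N'[of "n+m" n'] b(1)] m n' by auto
              have "d x c \<le> d (b m) x + d (b m) c"
                using triangle[of x "b m" c] x bM[of m] c \<sigma>M[of n'] commute[of x "b m"] by auto
              then show ?thesis using c m by (intro bexI[of _ c]) auto
            qed
            then show ?thesis by blast
          qed
          then show ?thesis using x by (simp add: L_def)
        qed
        moreover have "d x a \<le> e"
        proof -
          obtain m where m: "d (b m) x < e/2" using near[of "e/2" 0] e by auto
          have "d x a \<le> d x (b m) + d (b m) a" using x bM a \<sigma>M[of n] by (intro triangle) auto
          then show ?thesis using m b(2)[of m] commute[of x "b m"] commute[of a "b m"] by linarith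
        qed
        ultimately show ?thesis by blast
      qed
      have 2: "\<exists>a\<in>\<sigma> n. d x a \<le> e" if n: "n \<ge> N" and x: "x \<in> L" for n x
      proof -
        obtain N' where N': "\<forall>n\<ge>N'. \<exists>a\<in>\<sigma> n. d x a < e/2"
          using x e unfolding L_def by (auto dest!: spec[of _ "e/2"])
        obtain a where a: "a \<in> \<sigma> (max N N')" "d x a < e/2" using N' by (meson max.cobounded2)
        obtain b where b: "b \<in> \<sigma> n" "d a b < e/2"
          using ex[OF \<sigma> \<sigma> N[of "max N N'" n] a(1)] n by auto
        have "d x b \<le> d x a + d a b"
          using x a b \<sigma>M by (intro triangle) (auto simp: L_def)
        then show ?thesis using a b by (intro bexI[of _ b]) auto
      qed
      show ?thesis using 1 2 by blast
    qed
    have "L \<noteq> {}"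
      using key[of 1] hyperspace_nonempty[OF \<sigma>] by (metis all_not_in_conv order_refl zero_less_one)
    then have L: "L \<in> hyperspace" using L_clo by (simp add: hyperspace_def)
    have "limitin H.mtopology \<sigma> L sequentially"
      unfolding H.limitin_metric
    proof (intro conjI allI impI L)
      fix e :: real assume e: "e > 0"
      obtain N where N: "\<forall>n\<ge>N. (\<forall>a\<in>\<sigma> n. \<exists>x\<in>L. d x a \<le> e/2) \<and> (\<forall>x\<in>L. \<exists>a\<in>\<sigma> n. d x a \<le> e/2)"
        using key[of "e/2"] e by auto
      have "hausdorff_dist (\<sigma> n) L \<le> e/2" if "n \<ge> N" for n
        using N that by (intro hausdorff_dist_le \<sigma> L) (auto simp: commute)
      then show "\<forall>\<^sub>F n in sequentially. \<sigma> n \<in> hyperspace \<and> hausdorff_dist (\<sigma> n) L < e"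
        using e \<sigma> by (force simp: eventually_sequentially)
    qed
    then show "\<exists>x. limitin H.mtopology \<sigma> x sequentially" by blast
  qed
  ultimately show ?thesis by (simp add: H.compact_space_eq_mcomplete_mtotally_bounded)
qed

end

context dynamical_system
begin

lemma uniformly_continuous:
  assumes "e > 0"
  shows "\<exists>\<delta>>0. \<forall>x\<in>X. \<forall>y\<in>X. d x y < \<delta> \<longrightarrow> d (T x) (T y) < e"
proof -
  have "uniformly_continuous_map Self Self T"
    using compact continuous
    by (intro continuous_imp_uniformly_continuous_map) (simp add: mtopology_of_def)
  then show ?thesis using assms by (auto simp: uniformly_continuous_map_def commute)
qed

lemma image_hyperspace:
  assumes "A \<in> hyperspace"
  shows "T ` A \<in> hyperspace"
proof -
  have "compactin mtopology (T ` A)"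
    using assms compact continuous
    by (intro image_compactin) (auto simp: hyperspace_def intro: closedin_compact_space)
  then show ?thesis
    using assms by (simp add: hyperspace_def compactin_imp_closedin Hausdorff_space_mtopology)
qed

theorem dynamical_system_hyperspace: "dynamical_system hyperspace hausdorff_dist ((`) T)"
proof -
  interpret H: Metric_space hyperspace hausdorff_dist by (rule Metric_space_hyperspace[OF compact])
  show ?thesis
  proof
    show "compact_space H.mtopology" by (rule compact_space_hyperspace[OF compact])
    show "continuous_map H.mtopology H.mtopology ((`) T)"
      unfolding H.metric_continuous_map[OF H.Metric_space_axioms]
    proof (intro conjI ballI allI impI)
      show "(`) T ` hyperspace \<subseteq> hyperspace" using image_hyperspace by blast
      fix A and e :: real assume A: "A \<in> hyperspace" and e: "e > 0"
      then obtain \<delta> where \<delta>: "\<delta> > 0" "\<And>x y. x \<in> X \<Longrightarrow> y \<in> X \<Longrightarrow> d x y < \<delta> \<Longrightarrow> d (T x) (T y) < e/2"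
        using uniformly_continuous[of "e/2"] by auto
      have "hausdorff_dist (T ` A) (T ` B) < e" if B: "B \<in> hyperspace" and AB: "hausdorff_dist A B < \<delta>" for B
      proof -
        have *: "\<exists>b\<in>T ` B. d a b \<le> e/2"
          if A: "A \<in> hyperspace" and B: "B \<in> hyperspace" and AB: "hausdorff_dist A B < \<delta>"
            and a: "a \<in> T ` A" for A B a
        proof -
          obtain a' where a': "a' \<in> A" "a = T a'" using a by blast
          obtain b where b: "b \<in> B" "d a' b < \<delta>"
            using hausdorff_dist_bound_exists[OF compact A B AB a'(1)] by blast
          then have "d (T a') (T b) < e/2"
            using a' hyperspace_subset[OF A] hyperspace_subset[OF B] by (intro \<delta>(2)) auto
          then show ?thesis using a' b by (intro bexI[of _ "T b"]) auto
        qed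
        have "hausdorff_dist (T ` A) (T ` B) \<le> e/2"
        proof (intro hausdorff_dist_le image_hyperspace A B)
          show "\<exists>b\<in>T ` B. d a b \<le> e/2" if "a \<in> T ` A" for a using *[OF A B AB that] .
          show "\<exists>a\<in>T ` A. d a b \<le> e/2" if "b \<in> T ` B" for b
            using *[OF B A _ that] AB by (simp add: hausdorff_dist_commute[of B] commute[of b])
        qed
        then show ?thesis using e by simp
      qed
      then show "\<exists>\<delta>>0. \<forall>B. B \<in> hyperspace \<and> hausdorff_dist A B < \<delta> \<longrightarrow> hausdorff_dist (T ` A) (T ` B) < e"
        using \<delta>(1) by blast
    qed
    show "(`) T ` hyperspace = hyperspace"
    proof
      show "(`) T ` hyperspace \<subseteq> hyperspace" using image_hyperspace by blast
      show "hyperspace \<subseteq> (`) T ` hyperspace"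
      proof
        fix B assume B: "B \<in> hyperspace"
        let ?A = "{x \<in> X. T x \<in> B}"
        have "closedin mtopology ?A"
          using closedin_continuous_map_preimage[OF continuous] B by (simp add: hyperspace_def)
        moreover have im: "T ` ?A = B"
        proof
          show "B \<subseteq> T ` ?A"
          proof
            fix y assume y: "y \<in> B"
            then have "y \<in> T ` X" using hyperspace_subset[OF B] surjective by auto
            then show "y \<in> T ` ?A" using y by auto
          qed
        qed auto
        moreover have "?A \<noteq> {}"
          using im hyperspace_nonempty[OF B] by (metis image_empty)
        ultimately have "?A \<in> hyperspace" by (simp add: hyperspace_def)
        then show "B \<in> (`) T ` hyperspace" by (rule rev_image_eqI) (rule im[symmetric])
      qed
    qed
  qed
qed

end

end

theory Submission
  imports Defs
begin

text \<open>
  The diam-mean equicontinuity points of the hyperspace include every finite non-empty set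
  \<open>F\<close> of diam-mean equicontinuity points of \<open>X\<close>. Indeed, if \<open>A\<close> and \<open>B\<close> are both Hausdorff-close
  to \<open>F\<close>, then each point of \<open>A\<close> lies in a small ball around some \<open>f \<in> F\<close>, and that ball contains
  a point of \<open>B\<close> too, and vice versa. Hence the distance of \<open>T\<^sup>k A\<close> and \<open>T\<^sup>k B\<close> is at
  most the largest of the diameters of the \<open>T\<^sup>k\<close>-images of these balls. The point attaining
  this maximum may vary with \<open>k\<close>; the sum over the fixed finite set \<open>F\<close> also bounds it, and
  commutes with averaging over \<open>k\<close> (\<open>hausdorff_dist_funpow_le_sum\<close>,
  \<open>diam_mean_equicontinuity_point_finite_set\<close>).

  It remains to note that the finite non-empty subsets of a dense set are dense in the
  hyperspace: a compact set is approximated by a finite net, whose points can be moved into the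
  dense set (\<open>finite_subsets_of_dense_set_approximate\<close>).
\<close>

lemma funpow_image:
  fixes T :: "'a \<Rightarrow> 'a"
  shows "((`) T ^^ k) A = (T ^^ k) ` A"
  by (induction k) (simp_all add: image_comp)

context Metric_space
begin

lemma dist_le_mdiameter:
  assumes "compact_space mtopology" "A \<subseteq> M" "x \<in> A" "y \<in> A"
  shows "d x y \<le> mdiameter A"
proof -
  have "mbounded M"
    using assms(1) compactin_imp_mbounded by (simp add: compact_space_def)
  then obtain K where "\<And>x y. x \<in> M \<Longrightarrow> y \<in> M \<Longrightarrow> d x y \<le> K"
    unfolding mbounded_alt by blast
  then have "bdd_above ((\<lambda>(x, y). d x y) ` (A \<times> A))"
    using assms(2) by (intro bdd_aboveI[of _ K]) auto
  then have "(case (x, y) of (x, y) \<Rightarrow> d x y) \<le> (SUP (x, y) \<in> A \<times> A. d x y)"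
    using assms by (intro cSUP_upper) auto
  then show ?thesis using assms by (auto simp: mdiameter_def)
qed

lemma mdiameter_nonneg:
  assumes "compact_space mtopology" "A \<subseteq> M"
  shows "0 \<le> mdiameter A"
proof (cases "A = {}")
  case False
  then obtain x where "x \<in> A" by blast
  then show ?thesis
    using dist_le_mdiameter[OF assms, of x x] nonneg order_trans by blast
qed (simp add: mdiameter_def)

lemma mdiameter_le:
  assumes "0 \<le> r" "\<And>x y. x \<in> A \<Longrightarrow> y \<in> A \<Longrightarrow> d x y \<le> r"
  shows "mdiameter A \<le> r"
  using assms by (auto simp: mdiameter_def intro!: cSUP_least)

lemma finite_in_hyperspace:
  assumes "finite F" "F \<subseteq> M" "F \<noteq> {}"
  shows "F \<in> hyperspace"
proof -
  have "compactin mtopology F" using assms by (intro finite_imp_compactin) auto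
  then show ?thesis
    using assms by (simp add: hyperspace_def compactin_imp_closedin Hausdorff_space_mtopology)
qed

lemma finite_subsets_of_dense_set_approximate:
  assumes comp: "compact_space mtopology" and dense: "mtopology closure_of D = M"
    and A: "A \<in> hyperspace" and r: "r > 0"
  shows "\<exists>F. finite F \<and> F \<noteq> {} \<and> F \<subseteq> D \<inter> M \<and> hausdorff_dist A F < r"
proof -
  note AM = hyperspace_subset[OF A]
  have "compactin mtopology A"
    using A comp by (auto simp: hyperspace_def intro: closedin_compact_space)
  then have "mtotally_bounded A" by (rule compactin_imp_mtotally_bounded)
  then obtain K where K: "finite K" "K \<subseteq> A" "A \<subseteq> (\<Union>x\<in>K. mball x (r/3))"
    using r unfolding mtotally_bounded_def by (meson divide_pos_pos zero_less_numeral)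
  have "\<exists>y\<in>D \<inter> M. d x y < r/3" if "x \<in> M" for x
  proof -
    have "x \<in> mtopology closure_of D" using that dense by simp
    then obtain y where "y \<in> D" "y \<in> mball x (r/3)"
      using r unfolding metric_closure_of by (auto dest!: spec[of _ "r/3"])
    then show ?thesis by auto
  qed
  then obtain g where g: "\<And>x. x \<in> M \<Longrightarrow> g x \<in> D \<inter> M" "\<And>x. x \<in> M \<Longrightarrow> d x (g x) < r/3"
    by metis
  have sub: "g ` K \<subseteq> D \<inter> M" using K(2) AM g(1) by blast
  have ne: "g ` K \<noteq> {}" using K(3) hyperspace_nonempty[OF A] by auto
  have "hausdorff_dist A (g ` K) \<le> 2 * r / 3"
  proof (rule hausdorff_dist_le[OF A])
    show "g ` K \<in> hyperspace" using sub ne K(1) by (intro finite_in_hyperspace) auto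
    show "\<exists>b\<in>g ` K. d a b \<le> 2 * r / 3" if a: "a \<in> A" for a
    proof -
      obtain x where x: "x \<in> K" "x \<in> M" "d x a < r/3" using K(3) a by auto
      have "d a (g x) \<le> d a x + d x (g x)" using a AM x g(1)[of x] by (intro triangle) auto
      then show ?thesis using x g(2)[of x] commute[of a x] by (intro bexI[of _ "g x"]) auto
    qed
    show "\<exists>a\<in>A. d a b \<le> 2 * r / 3" if "b \<in> g ` K" for b
    proof -
      obtain x where x: "x \<in> K" "b = g x" using \<open>b \<in> g ` K\<close> by blast
      then show ?thesis using K(2) AM g(2)[of x] r by (intro bexI[of _ x]) auto
    qed
  qed
  then show ?thesis using sub ne K(1) r by (intro exI[of _ "g ` K"]) auto
qed

end

context dynamical_system
begin

lemma funpow_in_space: "x \<in> X \<Longrightarrow> (T ^^ k) x \<in> X"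
  using surjective by (induction k) auto

lemma funpow_image_hyperspace: "A \<in> hyperspace \<Longrightarrow> (T ^^ k) ` A \<in> hyperspace"
  unfolding funpow_image[symmetric] by (induction k) (auto simp: image_hyperspace)

text \<open>Both \<open>A\<close> and \<open>B\<close> are contained in the union of the balls around the points of \<open>F\<close>, and
  both meet every one of these balls. So a point of \<open>A\<close> always shares a ball with a point of
  \<open>B\<close>, and along the orbit their distance is controlled by the image of that ball.\<close>

lemma hausdorff_dist_funpow_le_sum:
  assumes F: "finite F" "F \<in> hyperspace" and A: "A \<in> hyperspace" and B: "B \<in> hyperspace"
    and FA: "hausdorff_dist F A < r" and FB: "hausdorff_dist F B < r"
  shows "hausdorff_dist ((T ^^ k) ` A) ((T ^^ k) ` B)
           \<le> (\<Sum>f\<in>F. mdiameter ((T ^^ k) ` mcball f r))"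
proof -
  have sub: "(T ^^ k) ` mcball f r \<subseteq> X" for f using funpow_in_space by auto
  note FX = hyperspace_subset[OF F(2)]
  have *: "\<exists>b\<in>(T ^^ k) ` B. d a b \<le> (\<Sum>f\<in>F. mdiameter ((T ^^ k) ` mcball f r))"
    if A: "A \<in> hyperspace" and B: "B \<in> hyperspace"
      and FA: "hausdorff_dist F A < r" and FB: "hausdorff_dist F B < r"
      and a: "a \<in> (T ^^ k) ` A" for A B a
  proof -
    obtain x where x: "x \<in> A" "a = (T ^^ k) x" using a by blast
    obtain f where f: "f \<in> F" "d x f < r"
      using hausdorff_dist_bound_exists[OF compact A F(2) _ x(1)] FA
      by (metis hausdorff_dist_commute)
    obtain y where y: "y \<in> B" "d f y < r"
      using hausdorff_dist_bound_exists[OF compact F(2) B FB f(1)] by blast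
    have "x \<in> mcball f r" "y \<in> mcball f r"
      using x y f FX hyperspace_subset[OF A] hyperspace_subset[OF B] commute[of x f] by auto
    then have "d a ((T ^^ k) y) \<le> mdiameter ((T ^^ k) ` mcball f r)"
      unfolding x(2) by (intro dist_le_mdiameter[OF compact sub]) auto
    also have "\<dots> \<le> (\<Sum>f\<in>F. mdiameter ((T ^^ k) ` mcball f r))"
      using f(1) F(1) mdiameter_nonneg[OF compact sub] by (intro member_le_sum) auto
    finally show ?thesis using y(1) by blast
  qed
  show ?thesis
  proof (intro hausdorff_dist_le funpow_image_hyperspace A B)
    show "\<exists>b\<in>(T ^^ k) ` B. d a b \<le> (\<Sum>f\<in>F. mdiameter ((T ^^ k) ` mcball f r))"
      if "a \<in> (T ^^ k) ` A" for a
      using *[OF A B FA FB that] .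
    show "\<exists>a\<in>(T ^^ k) ` A. d a b \<le> (\<Sum>f\<in>F. mdiameter ((T ^^ k) ` mcball f r))"
      if "b \<in> (T ^^ k) ` B" for b
      using *[OF B A FB FA that] by (simp add: commute[of b])
  qed
qed

lemma mdiameter_funpow_mono:
  assumes "A \<subseteq> B" "B \<subseteq> X"
  shows "mdiameter ((T ^^ k) ` A) \<le> mdiameter ((T ^^ k) ` B)"
proof (rule mdiameter_le)
  have sub: "(T ^^ k) ` B \<subseteq> X" using assms funpow_in_space by auto
  show "0 \<le> mdiameter ((T ^^ k) ` B)" by (rule mdiameter_nonneg[OF compact sub])
  show "d x y \<le> mdiameter ((T ^^ k) ` B)" if "x \<in> (T ^^ k) ` A" "y \<in> (T ^^ k) ` A" for x y
    using that assms by (intro dist_le_mdiameter[OF compact sub]) auto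
qed

lemma mean_diameter_mono:
  assumes "A \<subseteq> B" "B \<subseteq> X"
  shows "mean_diameter A \<le> mean_diameter B"
  unfolding mean_diameter_def
  by (intro Limsup_mono always_eventually allI ereal_less_eq(3)[THEN iffD2] mult_left_mono
      sum_mono mdiameter_funpow_mono assms) auto

text \<open>The mean diameter is monotone, so the smallest of the finitely many radii will do.\<close>

lemma common_radius:
  assumes "finite F" "\<And>f. f \<in> F \<Longrightarrow> diam_mean_equicontinuity_point f" "0 < (\<epsilon>::real)"
  shows "\<exists>r>0. \<forall>f\<in>F. mean_diameter (mcball f r) < ereal \<epsilon>"
proof -
  have "\<forall>f\<in>F. \<exists>\<delta>>0. mean_diameter (mcball f \<delta>) < ereal \<epsilon>"
    using assms(2,3) unfolding diam_mean_equicontinuity_point_def by blast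
  then obtain \<delta> where \<delta>: "\<And>f. f \<in> F \<Longrightarrow> 0 < \<delta> f"
      "\<And>f. f \<in> F \<Longrightarrow> mean_diameter (mcball f (\<delta> f)) < ereal \<epsilon>"
    by metis
  \<comment> \<open>The extra element 1 only serves to give the minimum a value when \<open>F\<close> is empty.\<close>
  define r where "r = Min (insert 1 (\<delta> ` F))"
  have "mean_diameter (mcball f r) < ereal \<epsilon>" if f: "f \<in> F" for f
  proof -
    have "r \<le> \<delta> f" using assms(1) f by (auto simp: r_def)
    then have "mean_diameter (mcball f r) \<le> mean_diameter (mcball f (\<delta> f))"
      by (intro mean_diameter_mono mcball_subset_concentric) auto
    then show ?thesis using \<delta>(2)[OF f] by simp
  qed
  moreover have "r > 0" using assms(1) \<delta>(1) by (auto simp: r_def)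
  ultimately show ?thesis by blast
qed

lemma diam_mean_equicontinuity_point_finite_set:
  assumes F: "finite F" "F \<noteq> {}" "\<And>f. f \<in> F \<Longrightarrow> diam_mean_equicontinuity_point f"
  shows "dynamical_system.diam_mean_equicontinuity_point hyperspace hausdorff_dist ((`) T) F"
proof -
  interpret H: dynamical_system hyperspace hausdorff_dist "(`) T"
    by (rule dynamical_system_hyperspace)
  have "F \<subseteq> X" using F(3) by (auto simp: diam_mean_equicontinuity_point_def)
  then have FH: "F \<in> hyperspace" using F by (intro finite_in_hyperspace)
  have "\<exists>\<delta>>0. H.mean_diameter (H.mcball F \<delta>) < ereal \<epsilon>" if \<epsilon>: "\<epsilon> > 0" for \<epsilon> :: real
  proof -
    \<comment> \<open>The limit superior only bounds the averages eventually by \<open>\<epsilon>/2\<close>; the remaining half makes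
      the final inequality strict.\<close>
    define e where "e = \<epsilon> / (2 * card F)"
    have e: "e > 0" using \<epsilon> F by (simp add: e_def card_gt_0_iff)
    obtain r where r: "r > 0" "\<And>f. f \<in> F \<Longrightarrow> mean_diameter (mcball f r) < ereal e"
      using common_radius[OF F(1,3) e] by blast
    have sub: "(T ^^ k) ` mcball f r \<subseteq> X" for f k using funpow_in_space by auto
    have diam: "H.mdiameter (((`) T ^^ k) ` H.mcball F (r/2))
        \<le> (\<Sum>f\<in>F. mdiameter ((T ^^ k) ` mcball f r))" for k
    proof (rule H.mdiameter_le)
      show "0 \<le> (\<Sum>f\<in>F. mdiameter ((T ^^ k) ` mcball f r))"
        using mdiameter_nonneg[OF compact sub] by (intro sum_nonneg)
      fix S R assume "S \<in> ((`) T ^^ k) ` H.mcball F (r/2)" "R \<in> ((`) T ^^ k) ` H.mcball F (r/2)"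
      then obtain A B where "A \<in> H.mcball F (r/2)" "B \<in> H.mcball F (r/2)"
        and SR: "S = (T ^^ k) ` A" "R = (T ^^ k) ` B"
        by (auto simp: funpow_image)
      then show "hausdorff_dist S R \<le> (\<Sum>f\<in>F. mdiameter ((T ^^ k) ` mcball f r))"
        unfolding SR using r(1) by (intro hausdorff_dist_funpow_le_sum F FH) auto
    qed
    have "\<forall>\<^sub>F n in sequentially. \<forall>f\<in>F.
        (1 / real n) * (\<Sum>k<n. mdiameter ((T ^^ k) ` mcball f r)) < e"
    proof (intro eventually_ball_finite F ballI)
      fix f assume "f \<in> F"
      then have "\<forall>\<^sub>F n in sequentially.
          ereal ((1 / real n) * (\<Sum>k<n. mdiameter ((T ^^ k) ` mcball f r))) < ereal e"
        using r(2) unfolding mean_diameter_def by (intro Limsup_lessD)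
      then show "\<forall>\<^sub>F n in sequentially.
          (1 / real n) * (\<Sum>k<n. mdiameter ((T ^^ k) ` mcball f r)) < e" by simp
    qed
    then have "\<forall>\<^sub>F n in sequentially.
        ereal ((1 / real n) * (\<Sum>k<n. H.mdiameter (((`) T ^^ k) ` H.mcball F (r/2)))) \<le> ereal (\<epsilon>/2)"
    proof (rule eventually_mono)
      fix n assume n: "\<forall>f\<in>F. (1 / real n) * (\<Sum>k<n. mdiameter ((T ^^ k) ` mcball f r)) < e"
      have "(1 / real n) * (\<Sum>k<n. H.mdiameter (((`) T ^^ k) ` H.mcball F (r/2)))
          \<le> (1 / real n) * (\<Sum>k<n. \<Sum>f\<in>F. mdiameter ((T ^^ k) ` mcball f r))"
        by (intro mult_left_mono sum_mono diam) auto
      also have "\<dots> = (\<Sum>f\<in>F. (1 / real n) * (\<Sum>k<n. mdiameter ((T ^^ k) ` mcball f r)))"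
        by (subst sum.swap) (simp add: sum_distrib_left)
      also have "\<dots> \<le> (\<Sum>f\<in>F. e)"
        using n by (intro sum_mono) (simp add: less_imp_le)
      also have "\<dots> = \<epsilon>/2" using F by (simp add: e_def)
      finally show "ereal ((1 / real n) * (\<Sum>k<n. H.mdiameter (((`) T ^^ k) ` H.mcball F (r/2))))
          \<le> ereal (\<epsilon>/2)" by simp
    qed
    then have "H.mean_diameter (H.mcball F (r/2)) \<le> ereal (\<epsilon>/2)"
      unfolding H.mean_diameter_def by (rule Limsup_bounded)
    also have "\<dots> < ereal \<epsilon>" using \<epsilon> by simp
    finally show ?thesis using r(1) by (intro exI[of _ "r/2"]) auto
  qed
  then show ?thesis using FH by (simp add: H.diam_mean_equicontinuity_point_def)
qed

end

theorem corollary5p6: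
  fixes X :: "'a set" and d :: "'a \<Rightarrow> 'a \<Rightarrow> real" and T :: "'a \<Rightarrow> 'a"
  assumes "dynamical_system X d T"
    and "dynamical_system.almost_diam_mean_equicontinuous X d T"
  shows "dynamical_system.almost_diam_mean_equicontinuous
           (Metric_space.hyperspace X d) (Metric_space.hausdorff_dist X d) ((`) T)"
proof -
  interpret dynamical_system X d T by (rule assms(1))
  interpret H: dynamical_system hyperspace hausdorff_dist "(`) T"
    by (rule dynamical_system_hyperspace)
  have dense: "mtopology closure_of {x. diam_mean_equicontinuity_point x} = X"
    using assms(2) by (simp add: almost_diam_mean_equicontinuous_def)
  have "A \<in> H.mtopology closure_of {A. H.diam_mean_equicontinuity_point A}"
    if A: "A \<in> hyperspace" for A
    unfolding H.metric_closure_of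
  proof (intro CollectI conjI A allI impI)
    fix r :: real assume "r > 0"
    then obtain F where F: "finite F" "F \<noteq> {}"
        "F \<subseteq> {x. diam_mean_equicontinuity_point x} \<inter> X" "hausdorff_dist A F < r"
      using finite_subsets_of_dense_set_approximate[OF compact dense A] by blast
    then have "F \<in> {A. H.diam_mean_equicontinuity_point A}"
      using diam_mean_equicontinuity_point_finite_set[of F] by blast
    moreover have "F \<in> H.mball A r" using F A by (simp add: finite_in_hyperspace)
    ultimately show "\<exists>y\<in>{A. H.diam_mean_equicontinuity_point A}. y \<in> H.mball A r" by blast
  qed
  then show ?thesis
    using closure_of_subset_topspace[of H.mtopology]
    by (auto simp: H.almost_diam_mean_equicontinuous_def)
qed

end
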